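(* Let $(x_1,x_2,x_3)\in\mathbb{R}^3$ with $(x_1,x_2,x_3)\neq(0,0,0)$. Then: (i) $(x_1+x_2-x_3)^4+5(x_1^2x_2^2+x_1^2x_3^2+x_2^2x_3^2)\geq 8(x_1^3x_2-x_1^3x_3-x_2x_3^3)+24x_1x_2x_3^2$, with equality if and only if $x_1=x_2=x_3$; (ii) $(x_1+x_2-x_3)^4+6(x_1^2x_2^2+x_1^2x_3^2+x_2^2x_3^2)> 8(x_1^3x_2-x_1^3x_3-x_2x_3^3)+24x_1x_2x_3^2$. Furthermore, the inequality in (i) and the strict inequality in (ii) still hold if $x_1^3x_2$, $x_1^3x_3$, $x_2x_3^3$ are simultaneously replaced by $x_1x_2^3$, $x_1x_3^3$, $x_2^3x_3$ respectively, that is, if $8(x_1^3x_2-x_1^3x_3-x_2x_3^3)$ is replaced by $8(x_1x_2^3-x_1x_3^3-x_2^3x_3)$ in the right-hand sides. *)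

theory Defs
  imports Complex_Main
begin

end

(* The difference of the two sides of (i) is a cyclic quartic form F, and the replaced inequality
   is F with its first two arguments exchanged.  Twice F is a sum of squares of cyclic shifts of
   x^2 - y^2 + a x y + b y z + c z x with a + b + c = 0, plus a multiple of the squares of the
   differences of x y, y z, z x; comparing the coefficients of x^3 y and x y^3 forces
   a = -8/3 and b = c = 4/3. *)
theory Submission
  imports Defs
begin

definition cyclic_quartic :: "real \<Rightarrow> real \<Rightarrow> real \<Rightarrow> real" where
  "cyclic_quartic x y z =
     (x + y - z)^4 + 5 * (x^2 * y^2 + x^2 * z^2 + y^2 * z^2)
       - (8 * (x^3 * y - x^3 * z - y * z^3) + 24 * x * y * z^2)"

text \<open>The factor 20/3 is fixed by the coefficient of x^2 y^2: -2 + a^2 + b^2 + c^2 + 2 * 20/3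
  = 22. The terms in x y z (x + y + z) then agree because both sides vanish at x = y = z.\<close>

lemma cyclic_quartic_sos:
  "2 * cyclic_quartic x y z =
     (x^2 - y^2 - 8/3 * (x * y) + 4/3 * (y * z) + 4/3 * (z * x))^2
   + (y^2 - z^2 - 8/3 * (y * z) + 4/3 * (z * x) + 4/3 * (x * y))^2
   + (z^2 - x^2 - 8/3 * (z * x) + 4/3 * (x * y) + 4/3 * (y * z))^2
   + 20/3 * ((x * y - y * z)^2 + (y * z - z * x)^2 + (z * x - x * y)^2)"
  unfolding cyclic_quartic_def by algebra

lemma cyclic_quartic_nonneg: "0 \<le> cyclic_quartic x y z"
proof -
  have "0 \<le> 2 * cyclic_quartic x y z"
    unfolding cyclic_quartic_sos by simp
  then show ?thesis by simp
qed

lemma cyclic_quartic_eq_0_iff: "cyclic_quartic x y z = 0 \<longleftrightarrow> x = y \<and> y = z"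
proof
  assume "cyclic_quartic x y z = 0"
  then have *: "(x^2 - y^2 - 8/3 * (x * y) + 4/3 * (y * z) + 4/3 * (z * x))^2
   + (y^2 - z^2 - 8/3 * (y * z) + 4/3 * (z * x) + 4/3 * (x * y))^2
   + (z^2 - x^2 - 8/3 * (z * x) + 4/3 * (x * y) + 4/3 * (y * z))^2
   + 20/3 * ((x * y - y * z)^2 + (y * z - z * x)^2 + (z * x - x * y)^2) = 0"
    using cyclic_quartic_sos[of x y z] by simp
  have products: "x * y = y * z" "y * z = z * x"
    and "x^2 - y^2 - 8/3 * (x * y) + 4/3 * (y * z) + 4/3 * (z * x) = 0"
    and "y^2 - z^2 - 8/3 * (y * z) + 4/3 * (z * x) + 4/3 * (x * y) = 0"
    using * by (simp_all add: add_nonneg_eq_0_iff)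
  \<comment> \<open>With all products equal, the product terms cancel because a + b + c = 0.\<close>
  then have squares: "x^2 = y^2" "y^2 = z^2"
    by linarith+
  show "x = y \<and> y = z"
  proof (cases "y = 0")
    case True
    then show ?thesis using squares by simp
  next
    case False
    \<comment> \<open>The squares leave the signs open; cancelling y in x y = y z and z in y z = z x
      settles them.\<close>
    then have "z \<noteq> 0" using squares by auto
    then show ?thesis using False products by simp
  qed
next
  assume "x = y \<and> y = z"
  then show "cyclic_quartic x y z = 0"
    using cyclic_quartic_sos[of x y z] by simp
qed

text \<open>The form is positive off the diagonal; at x = y = z \<noteq> 0 it vanishes, but the
  added sum is 3 x^4.\<close>

lemma cyclic_quartic_add_pos:
  assumes "(x, y, z) \<noteq> (0, 0, 0)"
  shows "0 < cyclic_quartic x y z + (x^2 * y^2 + x^2 * z^2 + y^2 * z^2)"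
proof (cases "cyclic_quartic x y z = 0")
  case True
  then have "x = y" "y = z" by (simp_all add: cyclic_quartic_eq_0_iff)
  then show ?thesis using assms True by (simp add: add_pos_pos)
next
  case False
  then have "0 < cyclic_quartic x y z"
    using cyclic_quartic_nonneg[of x y z] by simp
  then show ?thesis by (simp add: add_pos_nonneg)
qed

theorem corollary3p2:
  fixes x1 x2 x3 :: real
  assumes "(x1, x2, x3) \<noteq> (0, 0, 0)"
  shows
    "((x1 + x2 - x3)^4 + 5 * (x1^2 * x2^2 + x1^2 * x3^2 + x2^2 * x3^2)
        \<ge> 8 * (x1^3 * x2 - x1^3 * x3 - x2 * x3^3) + 24 * x1 * x2 * x3^2
      \<and> ((x1 + x2 - x3)^4 + 5 * (x1^2 * x2^2 + x1^2 * x3^2 + x2^2 * x3^2)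
            = 8 * (x1^3 * x2 - x1^3 * x3 - x2 * x3^3) + 24 * x1 * x2 * x3^2
          \<longleftrightarrow> x1 = x2 \<and> x2 = x3))
     \<and> (x1 + x2 - x3)^4 + 6 * (x1^2 * x2^2 + x1^2 * x3^2 + x2^2 * x3^2)
        > 8 * (x1^3 * x2 - x1^3 * x3 - x2 * x3^3) + 24 * x1 * x2 * x3^2
     \<and> (x1 + x2 - x3)^4 + 5 * (x1^2 * x2^2 + x1^2 * x3^2 + x2^2 * x3^2)
        \<ge> 8 * (x1 * x2^3 - x1 * x3^3 - x2^3 * x3) + 24 * x1 * x2 * x3^2
     \<and> (x1 + x2 - x3)^4 + 6 * (x1^2 * x2^2 + x1^2 * x3^2 + x2^2 * x3^2)
        > 8 * (x1 * x2^3 - x1 * x3^3 - x2^3 * x3) + 24 * x1 * x2 * x3^2"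
  \<comment> \<open>The instances at \<open>x2 x1 x3\<close> give the replaced inequalities, as all
    other terms are symmetric in \<open>x1\<close> and \<open>x2\<close>.\<close>
  using cyclic_quartic_nonneg[of x1 x2 x3] cyclic_quartic_eq_0_iff[of x1 x2 x3]
    cyclic_quartic_add_pos[of x1 x2 x3] cyclic_quartic_nonneg[of x2 x1 x3]
    cyclic_quartic_add_pos[of x2 x1 x3] assms
  unfolding cyclic_quartic_def by (simp add: algebra_simps)

end
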